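(* For every integer $m\ge 2$ there exists a constant $D=D(m)$ such that the following holds: if $H$ is any tree on $m$ vertices, then any edge colouring of $K_n$ in which every colour is used on at most $\frac1D\binom n2$ edges contains a rainbow copy of $H$.
   Context: An edge colouring of $K_n$ contains a rainbow copy of $H$ if some subgraph of $K_n$ isomorphic to $H$ has all its edges of pairwise distinct colours. *)

theory Defs
  imports Complex_Main "HOL-Library.Ramsey"
begin

text \<open>
  The digraph library in the AFP entry Graph_Theory models undirected graphs as symmetric digraphs,
  in which every edge already gives a directed cycle of length two, so its notions of forest and
  tree do not describe undirected trees. Graphs here are pairs (vertex set, edge set), with edges
  being two-element sets of vertices.
\<close>

type_synonym 'v ugraph = "'v set \<times> 'v set set"

abbreviation uverts :: "'v ugraph \<Rightarrow> 'v set" where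
  "uverts G \<equiv> fst G"

abbreviation uedges :: "'v ugraph \<Rightarrow> 'v set set" where
  "uedges G \<equiv> snd G"

definition simple_graph :: "'v ugraph \<Rightarrow> bool" where
  "simple_graph G \<longleftrightarrow> finite (uverts G) \<and> uedges G \<subseteq> [uverts G]\<^bsup>2\<^esup>"

definition is_path :: "'v ugraph \<Rightarrow> 'v list \<Rightarrow> bool" where
  "is_path G p \<longleftrightarrow> p \<noteq> [] \<and> set p \<subseteq> uverts G \<and> distinct p \<and>
     successively (\<lambda>u v. {u, v} \<in> uedges G) p"

definition is_cycle :: "'v ugraph \<Rightarrow> 'v list \<Rightarrow> bool" where
  "is_cycle G p \<longleftrightarrow> is_path G p \<and> length p \<ge> 3 \<and> {last p, hd p} \<in> uedges G"

definition connected_graph :: "'v ugraph \<Rightarrow> bool" where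
  "connected_graph G \<longleftrightarrow> uverts G \<noteq> {} \<and>
     (\<forall>u\<in>uverts G. \<forall>v\<in>uverts G. \<exists>p. is_path G p \<and> hd p = u \<and> last p = v)"

definition is_tree :: "'v ugraph \<Rightarrow> bool" where
  "is_tree G \<longleftrightarrow> simple_graph G \<and> connected_graph G \<and> (\<nexists>p. is_cycle G p)"

definition complete_graph :: "nat \<Rightarrow> nat ugraph" where
  "complete_graph n = ({..<n}, [{..<n}]\<^bsup>2\<^esup>)"

definition is_subgraph :: "'v ugraph \<Rightarrow> 'v ugraph \<Rightarrow> bool" where
  "is_subgraph F G \<longleftrightarrow> simple_graph F \<and> uverts F \<subseteq> uverts G \<and> uedges F \<subseteq> uedges G"

definition isomorphic_graphs :: "'v ugraph \<Rightarrow> 'w ugraph \<Rightarrow> bool" where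
  "isomorphic_graphs F G \<longleftrightarrow> (\<exists>f. bij_betw f (uverts F) (uverts G) \<and>
     (\<forall>u\<in>uverts F. \<forall>v\<in>uverts F. {u, v} \<in> uedges F \<longleftrightarrow> {f u, f v} \<in> uedges G))"

definition contains_rainbow_copy :: "'v ugraph \<Rightarrow> ('v set \<Rightarrow> 'c) \<Rightarrow> 'w ugraph \<Rightarrow> bool" where
  "contains_rainbow_copy G c H \<longleftrightarrow>
     (\<exists>F. is_subgraph F G \<and> isomorphic_graphs H F \<and> inj_on c (uedges F))"

end

theory Submission
  imports Defs
begin

text \<open>
  If every colour is rare, then among boundedly many random vertices no two disjoint edges share a
  colour. Ramsey's theorem for triples then yields vertices on which the colour of an edge determines
  its later endpoint, in a suitable linear order. Any forest can be ordered so that every vertex has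
  at most one earlier neighbour, and placing it along that linear order makes it rainbow.
\<close>

section \<open>Vertex orderings of acyclic graphs\<close>

text \<open>The head of a longest path inside \<open>S\<close> works: a neighbour in
  \<open>S\<close> off the path would prolong it, and a neighbour on the path beyond its second
  vertex would close a cycle. So its only possible neighbour in \<open>S\<close> is the second
  vertex of the path.\<close>

lemma acyclic_low_degree_vertex:
  assumes acyc: "\<nexists>p. is_cycle G p" and S: "finite S" "S \<noteq> {}" "S \<subseteq> uverts G"
    and loopfree: "\<And>v. {v} \<notin> uedges G"
  shows "\<exists>v\<in>S. \<forall>u\<in>S. \<forall>w\<in>S. {u, v} \<in> uedges G \<longrightarrow> {w, v} \<in> uedges G \<longrightarrow> u = w"
proof -
  define P where "P p \<longleftrightarrow> is_path G p \<and> set p \<subseteq> S" for p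
  obtain s where "s \<in> S" using S by blast
  then have "P [s]" using S by (auto simp: P_def is_path_def)
  moreover have "\<forall>p. P p \<longrightarrow> length p < Suc (card S)"
  proof (intro allI impI)
    fix p assume "P p"
    then have "length p = card (set p)" "set p \<subseteq> S"
      by (auto simp: P_def is_path_def distinct_card)
    then show "length p < Suc (card S)" using card_mono[OF S(1)] by (simp add: less_Suc_eq_le)
  qed
  ultimately obtain p where p: "P p" and longest: "\<And>q. P q \<Longrightarrow> length q \<le> length p"
    using ex_has_greatest_nat[of P "[s]" length "Suc (card S)"] by (metis less_imp_le)
  have path: "p \<noteq> []" "set p \<subseteq> uverts G" "distinct p"
      "successively (\<lambda>u v. {u, v} \<in> uedges G) p" "set p \<subseteq> S"
    using p by (auto simp: P_def is_path_def)
  have second: "1 < length p \<and> u = p ! 1" if u: "u \<in> S" "{u, hd p} \<in> uedges G" for u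
  proof -
    have "u \<in> set p"
    proof (rule ccontr)
      assume "u \<notin> set p"
      then have "P (u # p)"
        using path u S by (auto simp: P_def is_path_def successively_Cons)
      then show False using longest by fastforce
    qed
    then obtain k where k: "k < length p" "u = p ! k" by (metis in_set_conv_nth)
    have "k \<noteq> 0"
    proof
      assume "k = 0"
      then have "{hd p} \<in> uedges G" using k u path by (simp add: hd_conv_nth)
      then show False using loopfree by blast
    qed
    moreover have "\<not> 2 \<le> k"
    proof
      assume "2 \<le> k"
      \<comment> \<open>The initial segment ending at \<open>u\<close> has \<open>k + 1\<close>
        \<ge> 3 vertices, and the edge from \<open>u\<close> back to \<open>hd p\<close> closes it
        to a cycle.\<close>
      let ?q = "take (Suc k) p"
      have "set ?q \<subseteq> set p" by (rule set_take_subset)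
      then have "is_path G ?q"
        using path by (auto simp: is_path_def successively_conv_nth)
      moreover have "last ?q = u" "hd ?q = hd p"
        using k path by (simp_all add: take_Suc_conv_app_nth hd_append) (cases p; simp)
      ultimately have "is_cycle G ?q"
        using k u \<open>2 \<le> k\<close> by (simp add: is_cycle_def)
      then show False using acyc by blast
    qed
    ultimately have "k = 1" by simp
    then show ?thesis using k by simp
  qed
  have "hd p \<in> S" using path by (meson hd_in_set subsetD)
  then show ?thesis using second by metis
qed

text \<open>Induction on the size of \<open>S\<close>: a vertex with at most one neighbour in
  \<open>S\<close> is removed, the rest is ordered, and the vertex is put last. The graph
  \<open>G\<close> stays fixed and only \<open>S\<close> shrinks, so acyclicity need not be
  transferred to subgraphs.\<close>

lemma acyclic_degenerate_ordering:
  assumes acyc: "\<nexists>p. is_cycle G p" and loopfree: "\<And>v. {v} \<notin> uedges G"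
    and "finite S" "S \<subseteq> uverts G"
  shows "\<exists>h. bij_betw h S {..<card S} \<and>
    (\<forall>v\<in>S. \<forall>u\<in>S. \<forall>w\<in>S. {u, v} \<in> uedges G \<longrightarrow> {w, v} \<in> uedges G \<longrightarrow>
       h u < (h v :: nat) \<longrightarrow> h w < h v \<longrightarrow> u = w)"
  using assms(3,4)
proof (induction "card S" arbitrary: S)
  case 0
  then show ?case by (auto simp: bij_betw_def)
next
  case (Suc n)
  then have "S \<noteq> {}" by auto
  then obtain v where v: "v \<in> S"
    "\<And>u w. \<lbrakk>u \<in> S; w \<in> S; {u, v} \<in> uedges G; {w, v} \<in> uedges G\<rbrakk> \<Longrightarrow> u = w"
    using acyclic_low_degree_vertex[OF acyc _ _ _ loopfree, of S] Suc.prems by metis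
  let ?T = "S - {v}"
  have cT: "n = card ?T" using Suc.hyps(2) Suc.prems v by simp
  obtain h where h: "bij_betw h ?T {..<n}"
    "\<And>x u w. \<lbrakk>x \<in> ?T; u \<in> ?T; w \<in> ?T; {u, x} \<in> uedges G; {w, x} \<in> uedges G; h u < h x; h w < h x\<rbrakk> \<Longrightarrow> u = w"
    using Suc.hyps(1)[OF cT, folded cT] Suc.prems by (elim meta_impE exE conjE) blast+
  \<comment> \<open>In the last position, \<open>v\<close> is never an earlier neighbour of another
    vertex, and its own earlier neighbours are controlled by the choice of \<open>v\<close>.\<close>
  let ?h = "h(v := n)"
  have lt: "h x < n" if "x \<in> ?T" for x
    using h(1) that by (auto simp: bij_betw_def)
  have "bij_betw ?h ?T {..<n}"
    using h(1) by (subst bij_betw_cong[of ?T ?h h]) auto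
  then have "bij_betw ?h (?T \<union> {v}) ({..<n} \<union> {?h v})"
    by (intro notIn_Un_bij_betw) auto
  moreover have "?T \<union> {v} = S" using v by auto
  moreover have "{..<n} \<union> {?h v} = {..<card S}" using Suc.hyps(2) by auto
  ultimately have "bij_betw ?h S {..<card S}" by simp
  moreover have "u = w" if "x \<in> S" "u \<in> S" "w \<in> S" "{u, x} \<in> uedges G" "{w, x} \<in> uedges G"
    "?h u < ?h x" "?h w < ?h x" for x u w
  proof (cases "x = v")
    case True
    then show ?thesis using v(2) that by blast
  next
    case False
    then have "h x < n" using lt that by blast
    then have "u \<noteq> v" "w \<noteq> v" using that False by auto
    then show ?thesis using h(2)[of x u w] that False by auto
  qed
  ultimately show ?case by blast
qed

section \<open>Sampling vertices so that disjoint edges get different colours\<close>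

text \<open>A union bound written as counting: for each of at most \<open>N ^ 4\<close> quadruples
  of distinct indices, at most \<open>card Q * card V ^ (N - 4)\<close> maps send it into
  \<open>Q\<close>, and by \<open>few\<close> these do not exhaust all \<open>card V ^ N\<close>
  maps. Quadruples are nested as pairs of pairs because \<open>Q\<close> will compare two
  edges.\<close>

lemma exists_map_avoiding_quadruples:
  fixes V :: "'a set" and Q :: "(('a \<times> 'a) \<times> ('a \<times> 'a)) set"
  assumes V: "finite V" "V \<noteq> {}" and Q: "Q \<subseteq> (V \<times> V) \<times> (V \<times> V)" and N: "4 \<le> N"
    and few: "N ^ 4 * card Q < card V ^ 4"
  shows "\<exists>f\<in>{..<N} \<rightarrow> V. \<forall>i<N. \<forall>j<N. \<forall>k<N. \<forall>l<N. distinct [i, j, k, l] \<longrightarrow>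
    ((f i, f j), (f k, f l)) \<notin> Q"
proof -
  define I where "I = {..<N}"
  define T where "T = {(i, j, k, l). {i, j, k, l} \<subseteq> I \<and> distinct [i, j, k, l]}"
  \<comment> \<open>\<open>B t\<close> collects the maps that are bad at the index quadruple
    \<open>t\<close>; extensional functions make the set of all maps finite.\<close>
  define B where "B = (\<lambda>(i, j, k, l). {f \<in> I \<rightarrow>\<^sub>E V. ((f i, f j), (f k, f l)) \<in> Q})"
  have finI: "finite I" and cI: "card I = N" by (auto simp: I_def)
  have finQ: "finite Q" using Q by (rule finite_subset) (use V in simp)
  have finF: "finite (I \<rightarrow>\<^sub>E V)" using V finI by (intro finite_PiE) auto
  have Tsub: "T \<subseteq> I \<times> I \<times> I \<times> I" by (auto simp: T_def)
  then have finT: "finite T" by (rule finite_subset) (use finI in simp)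
  have "card T \<le> card (I \<times> I \<times> I \<times> I)" using finI Tsub by (intro card_mono) auto
  then have cT: "card T \<le> N ^ 4" by (simp add: cI card_cartesian_product numeral_eq_Suc)
  have cB: "card (B t) \<le> card Q * card V ^ (N - 4)" if "t \<in> T" for t
  proof -
    obtain i j k l where t: "t = (i, j, k, l)" by (cases t) auto
    then have d: "{i, j, k, l} \<subseteq> I" "distinct [i, j, k, l]" using that by (auto simp: T_def)
    let ?R = "I - {i, j, k, l}"
    \<comment> \<open>A bad map is encoded by its four values, which form an element of
      \<open>Q\<close>, and its restriction to the remaining \<open>N - 4\<close> indices.\<close>
    let ?\<phi> = "\<lambda>f. (((f i, f j), (f k, f l)), restrict f ?R)"
    have "inj_on ?\<phi> (B t)"
    proof (rule inj_onI)
      fix f g assume fg: "f \<in> B t" "g \<in> B t" "?\<phi> f = ?\<phi> g"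
      show "f = g"
      proof (rule PiE_ext)
        show "f \<in> I \<rightarrow>\<^sub>E V" "g \<in> I \<rightarrow>\<^sub>E V" using fg by (auto simp: B_def t)
        fix x assume x: "x \<in> I"
        show "f x = g x"
        proof (cases "x \<in> {i, j, k, l}")
          case True
          then show ?thesis using fg by auto
        next
          case False
          then have "restrict f ?R x = f x" "restrict g ?R x = g x" using x by auto
          then show ?thesis using fg(3) by (metis prod.inject)
        qed
      qed
    qed
    moreover have "?\<phi> ` B t \<subseteq> Q \<times> (?R \<rightarrow>\<^sub>E V)"
      by (force simp: B_def t restrict_PiE_iff)
    moreover have "finite (Q \<times> (?R \<rightarrow>\<^sub>E V))"
      using finQ V finI by (intro finite_cartesian_product finite_PiE) auto
    ultimately have "card (B t) \<le> card (Q \<times> (?R \<rightarrow>\<^sub>E V))"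
      by (rule card_inj_on_le)
    moreover have "card ?R = N - 4" using d finI cI by (subst card_Diff_subset) auto
    ultimately show ?thesis using finI by (simp add: card_cartesian_product card_funcsetE)
  qed
  have "card (\<Union>t\<in>T. B t) \<le> (\<Sum>t\<in>T. card (B t))" by (rule card_UN_le[OF finT])
  also have "\<dots> \<le> (\<Sum>t\<in>T. card Q * card V ^ (N - 4))" by (rule sum_mono[OF cB])
  also have "\<dots> \<le> (N ^ 4 * card Q) * card V ^ (N - 4)" using cT by simp
  also have "\<dots> < card V ^ 4 * card V ^ (N - 4)"
    using few V by (simp add: card_gt_0_iff)
  also have "\<dots> = card V ^ N" using N by (simp flip: power_add)
  also have "\<dots> = card (I \<rightarrow>\<^sub>E V)" using finI cI by (simp add: card_funcsetE)
  finally have less: "card (\<Union>t\<in>T. B t) < card (I \<rightarrow>\<^sub>E V)" .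
  have "\<not> (I \<rightarrow>\<^sub>E V) \<subseteq> (\<Union>t\<in>T. B t)"
  proof
    assume sub: "(I \<rightarrow>\<^sub>E V) \<subseteq> (\<Union>t\<in>T. B t)"
    have "finite (\<Union>t\<in>T. B t)" using finT finF by (auto simp: B_def split: prod.splits)
    then show False using card_mono[OF _ sub] less by simp
  qed
  then obtain f where f: "f \<in> I \<rightarrow>\<^sub>E V" "\<And>t. t \<in> T \<Longrightarrow> f \<notin> B t" by blast
  show ?thesis
  proof (rule bexI[of _ f])
    show "f \<in> {..<N} \<rightarrow> V" using f by (auto simp: I_def)
    show "\<forall>i<N. \<forall>j<N. \<forall>k<N. \<forall>l<N. distinct [i, j, k, l] \<longrightarrow> ((f i, f j), (f k, f l)) \<notin> Q"
    proof (intro allI impI)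
      fix i j k l assume "i < N" "j < N" "k < N" "l < N" "distinct [i, j, k, l]"
      then have "(i, j, k, l) \<in> T" by (auto simp: T_def I_def)
      then show "((f i, f j), (f k, f l)) \<notin> Q" using f by (fastforce simp: B_def)
    qed
  qed
qed

lemma card_ordered_pairs_of_colour:
  fixes c :: "nat set \<Rightarrow> 'c"
  shows "card {(x, y). x < n \<and> y < n \<and> x \<noteq> y \<and> c {x, y} = k}
    \<le> 2 * card {e \<in> [{..<n}]\<^bsup>2\<^esup>. c e = k}"
proof -
  let ?E = "{e \<in> [{..<n}]\<^bsup>2\<^esup>. c e = k}"
  \<comment> \<open>The Boolean records which of the two orientations of the edge is meant, whence
    the factor 2.\<close>
  let ?g = "\<lambda>(e, b). if b then (Min e, Max e) else (Max e, Min e :: nat)"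
  have fin: "finite ?E" by (simp add: finite_imp_finite_nsets)
  have "{(x, y). x < n \<and> y < n \<and> x \<noteq> y \<and> c {x, y} = k} \<subseteq> ?g ` (?E \<times> UNIV)"
  proof clarify
    fix x y assume xy: "x < n" "y < n" "x \<noteq> y" "k = c {x, y}"
    have "(x, y) = ?g ({x, y}, x < y)" using xy by auto
    moreover have "({x, y}, x < y) \<in> {e \<in> [{..<n}]\<^bsup>2\<^esup>. c e = c {x, y}} \<times> UNIV" using xy by simp
    ultimately show "(x, y) \<in> ?g ` ({e \<in> [{..<n}]\<^bsup>2\<^esup>. c e = c {x, y}} \<times> UNIV)" by (rule image_eqI)
  qed
  then have "card {(x, y). x < n \<and> y < n \<and> x \<noteq> y \<and> c {x, y} = k} \<le> card (?g ` (?E \<times> UNIV))"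
    using fin by (intro card_mono) auto
  also have "\<dots> \<le> card (?E \<times> (UNIV :: bool set))" using fin by (intro card_image_le) auto
  finally show ?thesis by (simp add: card_cartesian_product)
qed

text \<open>The bad quadruples are those with a repeated vertex in one of the two pairs,
  \<open>2 * n ^ 3\<close> at most, and those whose pairs share a colour, at most
  \<open>n ^ 4 / K\<^sup>2\<close>. Both counts are of order \<open>n ^ 4 / K\<close> once
  \<open>K\<close> \<le> \<open>n\<close> is known, and the choice of \<open>K\<close> then meets
  the counting bound.\<close>

lemma rare_colours_sample:
  fixes c :: "nat set \<Rightarrow> 'c" and K N n :: nat
  assumes rare: "\<And>k. K\<^sup>2 * card {e \<in> [{..<n}]\<^bsup>2\<^esup>. c e = k} \<le> n choose 2"
    and n: "2 \<le> n" and N: "4 \<le> N" and K: "3 * N ^ 4 < K"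
  shows "\<exists>f. inj_on f {..<N} \<and> f ` {..<N} \<subseteq> {..<n} \<and>
    (\<forall>i<N. \<forall>j<N. \<forall>k<N. \<forall>l<N. distinct [i, j, k, l] \<longrightarrow> c {f i, f j} \<noteq> c {f k, f l})"
proof -
  let ?V = "{..<n}"
  \<comment> \<open>\<open>A1\<close> and \<open>A2\<close> hold the quadruples with a degenerate
    pair; avoiding them will make the sample injective. \<open>A3\<close> handles the colour
    coincidences.\<close>
  define A1 where "A1 = Id_on ?V \<times> (?V \<times> ?V)"
  define A2 where "A2 = (?V \<times> ?V) \<times> Id_on ?V"
  define S where "S p = {(x, y). x < n \<and> y < n \<and> x \<noteq> y \<and> c {x, y} = c {fst p, snd p}}"
    for p :: "nat \<times> nat"
  define A3 where "A3 = Sigma (?V \<times> ?V) S"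
  have "2 * (n choose 2) \<le> n * (n - 1)" unfolding choose_two by (rule times_div_less_eq_dividend)
  also have "\<dots> \<le> n\<^sup>2" by (simp add: power2_eq_square)
  finally have two: "2 * (n choose 2) \<le> n\<^sup>2" .
  \<comment> \<open>The colour of the edge \<open>{0, 1}\<close> is used at least once, so rarity
    forces \<open>K\<^sup>2\<close> \<le> \<open>n choose 2\<close> and hence \<open>K\<close> \<le>
    \<open>n\<close>: rarity alone makes \<open>n\<close> large.\<close>
  have "{0, 1} \<in> {e \<in> [?V]\<^bsup>2\<^esup>. c e = c {0, 1}}" using n by simp
  then have "card {e \<in> [?V]\<^bsup>2\<^esup>. c e = c {0, 1}} \<noteq> 0"
    using finite_imp_finite_nsets[OF finite_lessThan, of n 2] by (subst card_eq_0_iff) force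
  then have "K\<^sup>2 \<le> K\<^sup>2 * card {e \<in> [?V]\<^bsup>2\<^esup>. c e = c {0, 1}}" by simp
  also have "\<dots> \<le> n\<^sup>2" using rare[of "c {0, 1}"] two by linarith
  finally have Kn: "K \<le> n" by simp
  have finS: "finite (S p)" for p
    by (rule finite_subset[of _ "?V \<times> ?V"]) (auto simp: S_def)
  have cId: "card (Id_on ?V) = n"
    by (simp add: Id_on_def card_UN_disjoint)
  have c1: "card A1 = n ^ 3" "card A2 = n ^ 3"
    by (simp_all add: A1_def A2_def card_cartesian_product cId numeral_eq_Suc)
  have "K\<^sup>2 * card (S p) \<le> n\<^sup>2" for p
  proof -
    have "K\<^sup>2 * card (S p) \<le> 2 * (K\<^sup>2 * card {e \<in> [?V]\<^bsup>2\<^esup>. c e = c {fst p, snd p}})"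
      using mult_le_mono2[OF card_ordered_pairs_of_colour[of n c "c {fst p, snd p}"], of "K\<^sup>2"]
      by (simp add: S_def)
    then show ?thesis using rare[of "c {fst p, snd p}"] two by linarith
  qed
  then have "(\<Sum>p\<in>?V \<times> ?V. K\<^sup>2 * card (S p)) \<le> (\<Sum>p\<in>?V \<times> ?V. n\<^sup>2)" by (intro sum_mono)
  moreover have "card A3 = (\<Sum>p\<in>?V \<times> ?V. card (S p))"
    unfolding A3_def using finS by (intro card_SigmaI) auto
  ultimately have "K\<^sup>2 * card A3 \<le> n\<^sup>2 * n\<^sup>2"
    by (simp add: sum_distrib_left card_cartesian_product power2_eq_square)
  then have c3: "K * (K * card A3) \<le> n ^ 4" by (simp add: power2_eq_square numeral_eq_Suc)
  define Q where "Q = A1 \<union> A2 \<union> A3"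
  have Qsub: "Q \<subseteq> (?V \<times> ?V) \<times> (?V \<times> ?V)"
    by (auto simp: Q_def A1_def A2_def A3_def S_def)
  have "card Q \<le> card A1 + card A2 + card A3"
    unfolding Q_def by (meson add_le_mono1 card_Un_le order_trans)
  then have "K * card Q \<le> K * (2 * n ^ 3 + card A3)" using c1 by simp
  also have "\<dots> = 2 * (K * n ^ 3) + K * card A3" by (simp add: algebra_simps)
  also have "\<dots> \<le> 2 * n ^ 4 + n ^ 4"
  proof (intro add_mono mult_le_mono2)
    show "K * n ^ 3 \<le> n ^ 4" using Kn by (simp add: numeral_eq_Suc)
    have "K * card A3 \<le> K * (K * card A3)" using K by simp
    then show "K * card A3 \<le> n ^ 4" using c3 by linarith
  qed
  finally have cQ: "K * card Q \<le> 3 * n ^ 4" by simp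
  have "K * (N ^ 4 * card Q) \<le> N ^ 4 * (3 * n ^ 4)"
    using mult_le_mono2[OF cQ, of "N ^ 4"] by (simp add: algebra_simps)
  also have "\<dots> = 3 * N ^ 4 * n ^ 4" by simp
  also have "\<dots> < K * n ^ 4" using K n by simp
  finally have "N ^ 4 * card Q < card ?V ^ 4" by simp
  from exists_map_avoiding_quadruples[OF _ _ Qsub N this] n
  obtain f where f: "f \<in> {..<N} \<rightarrow> ?V" and avoid: "\<And>i j k l. \<lbrakk>i < N; j < N; k < N; l < N;
      distinct [i, j, k, l]\<rbrakk> \<Longrightarrow> ((f i, f j), (f k, f l)) \<notin> Q"
    by (auto simp: lessThan_empty_iff)
  have sep: "f i \<noteq> f j \<and> f k \<noteq> f l \<and> c {f i, f j} \<noteq> c {f k, f l}"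
    if "i < N" "j < N" "k < N" "l < N" "distinct [i, j, k, l]" for i j k l
  proof -
    have "f i < n" "f j < n" "f k < n" "f l < n" using f that by auto
    then show ?thesis
      using avoid[OF that] by (auto simp: Q_def A1_def A2_def A3_def S_def)
  qed
  have "inj_on f {..<N}"
  proof (rule inj_onI, rule ccontr)
    fix i j assume ij: "i \<in> {..<N}" "j \<in> {..<N}" "f i = f j" "i \<noteq> j"
    \<comment> \<open>Two further indices, available as \<open>N\<close> \<ge> 4, complete
      \<open>i\<close> and \<open>j\<close> to a quadruple, at which \<open>sep\<close> separates
      their images.\<close>
    have "2 \<le> card ({..<N} - {i, j})" using ij N by (simp add: card_Diff_subset)
    then obtain k l where "k \<in> {..<N} - {i, j}" "l \<in> {..<N} - {i, j}" "k \<noteq> l"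
      by (metis card_le_Suc0_iff_eq finite_Diff finite_lessThan not_less_eq_eq numeral_2_eq_2)
    then show False using sep[of i j k l] ij by auto
  qed
  then show ?thesis using f sep by blast
qed

section \<open>Ramsey's theorem for triples and homogeneous colour patterns\<close>

text \<open>Ramsey's theorem for 3-sets, recast for functions of increasing triples: a 3-set is
  coloured through its sorted list, and the homogeneous set is enumerated increasingly.\<close>

lemma ramsey_ordered_triples:
  fixes M r :: nat
  obtains N :: nat where "\<And>q. (\<And>i j k. q i j k < r) \<Longrightarrow>
    \<exists>s a. strict_mono_on {..<M} s \<and> s ` {..<M} \<subseteq> {..<N} \<and>
      (\<forall>i j k. i < j \<longrightarrow> j < k \<longrightarrow> k < M \<longrightarrow> q (s i) (s j) (s k :: nat) = (a :: nat))"
proof -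
  obtain N :: nat where N: "partn_lst {..<N} (replicate r M) 3"
    using ramsey_full by blast
  show ?thesis
  proof (rule that[of N])
    fix q :: "nat \<Rightarrow> nat \<Rightarrow> nat \<Rightarrow> nat" assume q: "\<And>i j k. q i j k < r"
    define g where "g A = (let xs = sorted_list_of_set A in q (xs ! 0) (xs ! 1) (xs ! 2))" for A
    have "g \<in> nsets {..<N} 3 \<rightarrow> {..<r}" using q by (auto simp: g_def Let_def)
    then obtain a H where a: "a < r" and H: "H \<in> nsets {..<N} (replicate r M ! a)"
      "g ` nsets H 3 \<subseteq> {a}"
      using partn_lstE[OF N] by (metis length_replicate)
    have H': "H \<subseteq> {..<N}" "finite H" "card H = M" using H a by (auto simp: nsets_def)
    let ?s = "enumerate H"
    have "q (?s i) (?s j) (?s k) = a" if "i < j" "j < k" "k < M" for i j k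
    proof -
      have lt: "?s i < ?s j" "?s j < ?s k" using that H' by (simp_all add: finite_enumerate_mono)
      have "?s i \<in> H" "?s j \<in> H" "?s k \<in> H"
        using that H' by (simp_all add: finite_enumerate_in_set)
      then have "{?s i, ?s j, ?s k} \<in> nsets H 3" using lt by (auto simp: nsets_def)
      then have "g {?s i, ?s j, ?s k} = a" using H by blast
      moreover have "sorted_list_of_set {?s i, ?s j, ?s k} = [?s i, ?s j, ?s k]"
        using sorted_list_of_set.idem_if_sorted_distinct[of "[?s i, ?s j, ?s k]"] lt by simp
      ultimately show ?thesis by (simp add: g_def)
    qed
    moreover have "strict_mono_on {..<M} ?s"
      using H' by (auto intro!: strict_mono_onI finite_enumerate_mono)
    moreover have "?s ` {..<M} \<subseteq> {..<N}"
      using H' finite_enumerate_in_set by blast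
    ultimately show "\<exists>s a. strict_mono_on {..<M} s \<and> s ` {..<M} \<subseteq> {..<N} \<and>
      (\<forall>i j k. i < j \<longrightarrow> j < k \<longrightarrow> k < M \<longrightarrow> q (s i) (s j) (s k) = a)" by blast
  qed
qed

text \<open>Records the first coincidence among the edge colours of a triangle, with 3 for a rainbow
  triangle. It takes only four values however many colours occur, so Ramsey's theorem applies to
  it.\<close>

definition triple_pattern :: "(nat \<Rightarrow> nat \<Rightarrow> 'c) \<Rightarrow> nat \<Rightarrow> nat \<Rightarrow> nat \<Rightarrow> nat" where
  "triple_pattern d i j k =
     (if d i j = d i k then 0 else if d i j = d j k then 1 else if d i k = d j k then 2 else 3)"

text \<open>Pattern 0 makes the colour depend only on the smaller index, pattern 2 only on the
  larger, pattern 1 is impossible, and pattern 3 makes all edges differ. In patterns 0 and 2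
  different determining endpoints give different colours, since the other endpoints can be exchanged
  for spare indices until the edges are disjoint.\<close>

lemma homogeneous_colour_determines_later_endpoint:
  fixes d :: "nat \<Rightarrow> nat \<Rightarrow> 'c"
  assumes sym: "\<And>i j. d i j = d j i"
    and disj: "\<And>i j k l. \<lbrakk>i < m + 4; j < m + 4; k < m + 4; l < m + 4; distinct [i, j, k, l]\<rbrakk>
      \<Longrightarrow> d i j \<noteq> d k l"
    and hom: "\<And>i j k. \<lbrakk>i < j; j < k; k < m + 4\<rbrakk> \<Longrightarrow> triple_pattern d i j k = a"
  shows "\<exists>t. inj_on t {..<m} \<and> t ` {..<m} \<subseteq> {..<m + 4} \<and>
    (\<forall>i j i' j'. i < j \<longrightarrow> j < m \<longrightarrow> i' < j' \<longrightarrow> j' < m \<longrightarrow>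
       d (t i) (t j) = d (t i') (t j') \<longrightarrow> j = j')"
proof -
  have "a = triple_pattern d 0 1 2" using hom[of 0 1 2] by simp
  then consider "a = 0" | "a = 1" | "a = 2" | "a = 3" by (auto simp: triple_pattern_def split: if_splits)
  then show ?thesis
  proof cases
    case 1
    have eq: "d i j = d i k" if "i < j" "j < k" "k < m + 4" for i j k
      using hom[OF that] unfolding 1 triple_pattern_def by (simp_all split: if_split_asm)
    \<comment> \<open>Reversal turns the smaller index into the later endpoint. The indices
      \<open>m\<close> and \<open>m + 1\<close> lie above the image and replace the other
      endpoints.\<close>
    let ?t = "\<lambda>i. m - 1 - i"
    have "j = j'" if *: "i < j" "j < m" "i' < j'" "j' < m" "d (?t i) (?t j) = d (?t i') (?t j')"
      for i j i' j'
    proof (rule ccontr)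
      assume "j \<noteq> j'"
      have "d (?t j) (?t i) = d (?t j) m" using * by (intro eq) auto
      moreover have "d (?t j') (?t i') = d (?t j') (m + 1)" using * by (intro eq) auto
      moreover have "d (?t j) m \<noteq> d (?t j') (m + 1)" using * \<open>j \<noteq> j'\<close> by (intro disj) auto
      ultimately show False using * sym by metis
    qed
    moreover have "inj_on ?t {..<m}" by (auto simp: inj_on_def)
    moreover have "?t ` {..<m} \<subseteq> {..<m + 4}" by auto
    ultimately show ?thesis by (intro exI[of _ ?t]) blast
  next
    case 2
    have eq: "d i j = d j k" if "i < j" "j < k" "k < m + 4" for i j k
      using hom[OF that] unfolding 2 triple_pattern_def by (simp_all split: if_split_asm)
    \<comment> \<open>The coincidence propagates along the path 0, 1, 2, 3 and reaches a disjoint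
      edge.\<close>
    have "d 0 1 = d 2 3" using eq[of 0 1 2] eq[of 1 2 3] by simp
    then show ?thesis using disj[of 0 1 2 3] by simp
  next
    case 3
    have eq: "d i k = d j k" if "i < j" "j < k" "k < m + 4" for i j k
      using hom[OF that] unfolding 3 triple_pattern_def by (simp_all split: if_split_asm)
    \<comment> \<open>The shift frees 0 and 1 below the image, to replace the smaller
      endpoints.\<close>
    let ?t = "\<lambda>i. i + 2"
    have "j = j'" if *: "i < j" "j < m" "i' < j'" "j' < m" "d (?t i) (?t j) = d (?t i') (?t j')"
      for i j i' j'
    proof (rule ccontr)
      assume "j \<noteq> j'"
      have "d 0 (?t j) = d (?t i) (?t j)" using * by (intro eq) auto
      moreover have "d 1 (?t j') = d (?t i') (?t j')" using * by (intro eq) auto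
      moreover have "d 0 (?t j) \<noteq> d 1 (?t j')" using * \<open>j \<noteq> j'\<close> by (intro disj) auto
      ultimately show False using * by simp
    qed
    moreover have "inj_on ?t {..<m}" by (auto simp: inj_on_def)
    moreover have "?t ` {..<m} \<subseteq> {..<m + 4}" by auto
    ultimately show ?thesis by (intro exI[of _ ?t]) blast
  next
    case 4
    have neq: "d i j \<noteq> d i k" "d i j \<noteq> d j k" "d i k \<noteq> d j k"
      if "i < j" "j < k" "k < m + 4" for i j k
      using hom[OF that] unfolding 4 triple_pattern_def by (simp_all split: if_split_asm)
    have "j = j'" if *: "i < j" "j < m" "i' < j'" "j' < m" "d i j = d i' j'" for i j i' j'
    proof (rule ccontr)
      assume "j \<noteq> j'"
      \<comment> \<open>Edges with different later endpoints either share one vertex, and are then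
        two sides of a triangle with pattern 3, or are disjoint.\<close>
      then consider "i = i'" "j < j'" | "i = i'" "j' < j" | "i = j'" | "i' = j" | "distinct [i, j, i', j']"
        using * by force
      then show False
      proof cases
        case 1 then show ?thesis using neq(1)[of i j j'] * by simp
      next
        case 2 then show ?thesis using neq(1)[of i j' j] * by simp
      next
        case 3 then show ?thesis using neq(2)[of i' i j] * by simp
      next
        case 4 then show ?thesis using neq(2)[of i j j'] * by simp
      next
        case 5 then show ?thesis using disj[of i j i' j'] * by simp
      qed
    qed
    then show ?thesis by (intro exI[of _ "\<lambda>i. i"]) (auto simp: inj_on_def)
  qed
qed

text \<open>Composes three selections: a sample without colour coincidences between disjoint edges,
  a Ramsey-homogeneous subset of \<open>m + 4\<close> sample points, and the reordering
  \<open>t\<close> of \<open>m\<close> of them. \<open>K\<close> depends on \<open>m\<close>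
  alone.\<close>

lemma rare_colours_determine_later_endpoint:
  fixes m :: nat
  obtains K :: nat where "K > 0" "\<And>n (c :: nat set \<Rightarrow> 'c).
    \<lbrakk>2 \<le> n; \<And>k. K\<^sup>2 * card {e \<in> [{..<n}]\<^bsup>2\<^esup>. c e = k} \<le> n choose 2\<rbrakk> \<Longrightarrow>
    \<exists>e. inj_on e {..<m} \<and> e ` {..<m} \<subseteq> {..<n} \<and>
      (\<forall>i j i' j'. i < j \<longrightarrow> j < m \<longrightarrow> i' < j' \<longrightarrow> j' < m \<longrightarrow>
         c {e i, e j} = c {e i', e j'} \<longrightarrow> j = j')"
proof -
  obtain N where N: "\<And>q. (\<And>i j k. q i j k < 4) \<Longrightarrow>
    \<exists>s a. strict_mono_on {..<m + 4} s \<and> s ` {..<m + 4} \<subseteq> {..<N} \<and>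
      (\<forall>i j k. i < j \<longrightarrow> j < k \<longrightarrow> k < m + 4 \<longrightarrow> q (s i) (s j) (s k :: nat) = (a :: nat))"
    using ramsey_ordered_triples[of 4 "m + 4"] by blast
  \<comment> \<open>Sampling requires at least four indices, which the Ramsey number need not
    supply.\<close>
  define N' where "N' = max N 4"
  show ?thesis
  \<comment> \<open>This is the least \<open>K\<close> satisfying the bound
    \<open>3 * N' ^ 4 < K\<close> required for the sample.\<close>
  proof (rule that[of "Suc (3 * N' ^ 4)"])
    fix n and c :: "nat set \<Rightarrow> 'c"
    assume n: "2 \<le> n"
      and rare: "\<And>k. (Suc (3 * N' ^ 4))\<^sup>2 * card {e \<in> [{..<n}]\<^bsup>2\<^esup>. c e = k} \<le> n choose 2"
    obtain f where f: "inj_on f {..<N'}" "f ` {..<N'} \<subseteq> {..<n}"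
      "\<And>i j k l. \<lbrakk>i < N'; j < N'; k < N'; l < N'; distinct [i, j, k, l]\<rbrakk> \<Longrightarrow> c {f i, f j} \<noteq> c {f k, f l}"
      using rare_colours_sample[OF rare n, of N'] by (auto simp: N'_def)
    let ?q = "triple_pattern (\<lambda>i j. c {f i, f j})"
    have "?q i j k < 4" for i j k by (simp add: triple_pattern_def)
    from N[of ?q, OF this] obtain s a where s: "strict_mono_on {..<m + 4} s" "s ` {..<m + 4} \<subseteq> {..<N}"
      "\<And>i j k. \<lbrakk>i < j; j < k; k < m + 4\<rbrakk> \<Longrightarrow> ?q (s i) (s j) (s k) = a" by blast
    have sinj: "inj_on s {..<m + 4}" using s(1) by (rule strict_mono_on_imp_inj_on)
    have sN: "s i < N'" if "i < m + 4" for i using s(2) that by (auto simp: N'_def)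
    define d where "d i j = c {f (s i), f (s j)}" for i j
    have "\<exists>t. inj_on t {..<m} \<and> t ` {..<m} \<subseteq> {..<m + 4} \<and>
      (\<forall>i j i' j'. i < j \<longrightarrow> j < m \<longrightarrow> i' < j' \<longrightarrow> j' < m \<longrightarrow>
         d (t i) (t j) = d (t i') (t j') \<longrightarrow> j = j')"
    proof (rule homogeneous_colour_determines_later_endpoint)
      show "d i j = d j i" for i j by (simp add: d_def insert_commute)
      show "d i j \<noteq> d k l"
        if "i < m + 4" "j < m + 4" "k < m + 4" "l < m + 4" "distinct [i, j, k, l]" for i j k l
      proof -
        have "distinct [s i, s j, s k, s l]"
          using that sinj by (auto simp: inj_on_eq_iff)
        then show ?thesis unfolding d_def using f(3) sN that by blast
      qed
      show "triple_pattern d i j k = a" if "i < j" "j < k" "k < m + 4" for i j k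
        using s(3)[OF that] unfolding triple_pattern_def d_def .
    qed
    then obtain t where t: "inj_on t {..<m}" "t ` {..<m} \<subseteq> {..<m + 4}"
      "\<And>i j i' j'. \<lbrakk>i < j; j < m; i' < j'; j' < m; d (t i) (t j) = d (t i') (t j')\<rbrakk> \<Longrightarrow> j = j'"
      by blast
    let ?e = "f \<circ> s \<circ> t"
    have "inj_on (f \<circ> s) (t ` {..<m})"
    proof (rule comp_inj_on)
      show "inj_on s (t ` {..<m})" using sinj t(2) by (rule inj_on_subset)
      show "inj_on f (s ` t ` {..<m})"
        using f(1) by (rule inj_on_subset) (use t(2) sN in auto)
    qed
    with t(1) have "inj_on ?e {..<m}" by (rule comp_inj_on)
    moreover have "?e ` {..<m} \<subseteq> {..<n}"
    proof (rule image_subsetI)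
      fix i assume "i \<in> {..<m}"
      then have "s (t i) < N'" using t(2) sN by blast
      then show "?e i \<in> {..<n}" using f(2) by auto
    qed
    moreover have "j = j'" if "i < j" "j < m" "i' < j'" "j' < m" "c {?e i, ?e j} = c {?e i', ?e j'}"
      for i j i' j'
      by (rule t(3)[OF that(1-4)]) (use that(5) in \<open>simp add: d_def\<close>)
    ultimately show "\<exists>e. inj_on e {..<m} \<and> e ` {..<m} \<subseteq> {..<n} \<and>
      (\<forall>i j i' j'. i < j \<longrightarrow> j < m \<longrightarrow> i' < j' \<longrightarrow> j' < m \<longrightarrow>
         c {e i, e j} = c {e i', e j'} \<longrightarrow> j = j')"
      by blast
  qed simp
qed

section \<open>Rainbow embedding and the choice of the constant\<close>

text \<open>Each vertex \<open>v\<close> is placed at \<open>e (h v)\<close>, with \<open>h\<close>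
  a degenerate ordering. The colour of an embedded edge determines the position of its later
  endpoint, hence that vertex, and its unique earlier neighbour then recovers the edge.\<close>

lemma rainbow_copy_of_acyclic:
  fixes H :: "'w ugraph" and c :: "nat set \<Rightarrow> 'c"
  assumes H: "simple_graph H" "\<nexists>p. is_cycle H p" "card (uverts H) = m"
    and e: "inj_on e {..<m}" "e ` {..<m} \<subseteq> {..<n}"
    and later: "\<And>i j i' j'. \<lbrakk>i < j; j < m; i' < j'; j' < m; c {e i, e j} = c {e i', e j'}\<rbrakk> \<Longrightarrow> j = j'"
  shows "contains_rainbow_copy (complete_graph n) c H"
proof -
  have fin: "finite (uverts H)" and edges: "uedges H \<subseteq> [uverts H]\<^bsup>2\<^esup>"
    using H by (auto simp: simple_graph_def)
  have loopfree: "{v} \<notin> uedges H" for v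
    using edges by (auto simp: nsets_def)
  obtain h where h: "bij_betw h (uverts H) {..<m}"
    "\<And>v u w. \<lbrakk>v \<in> uverts H; u \<in> uverts H; w \<in> uverts H; {u, v} \<in> uedges H; {w, v} \<in> uedges H;
       h u < h v; h w < h v\<rbrakk> \<Longrightarrow> u = w"
    using acyclic_degenerate_ordering[OF H(2) loopfree fin order_refl] H(3) by blast
  let ?g = "e \<circ> h"
  let ?F = "(?g ` uverts H, (`) ?g ` uedges H)"
  have inj: "inj_on ?g (uverts H)"
    using h(1) e(1) by (intro comp_inj_on) (auto simp: bij_betw_def)
  have hm: "h v < m" if "v \<in> uverts H" for v using h(1) that by (auto simp: bij_betw_def)
  have gn: "?g ` uverts H \<subseteq> {..<n}" using e(2) hm by fastforce
  have Fedges: "uedges ?F \<subseteq> [?g ` uverts H]\<^bsup>2\<^esup>"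
  proof
    fix E' assume "E' \<in> uedges ?F"
    then obtain E where "E \<in> uedges H" and E': "E' = ?g ` E" by auto
    then have E: "E \<subseteq> uverts H" "finite E" "card E = 2" using edges by (auto simp: nsets_def)
    then have "card (?g ` E) = 2" using card_image inj inj_on_subset by metis
    then show "E' \<in> [?g ` uverts H]\<^bsup>2\<^esup>" unfolding E' using E by (auto simp: nsets_def)
  qed
  have "is_subgraph ?F (complete_graph n)"
    using fin gn Fedges nsets_mono[OF gn, of 2]
    by (simp add: is_subgraph_def simple_graph_def complete_graph_def)
  moreover have "isomorphic_graphs H ?F"
    unfolding isomorphic_graphs_def
  proof (intro exI[of _ ?g] conjI ballI)
    show "bij_betw ?g (uverts H) (uverts ?F)" using inj by (simp add: bij_betw_def)
    fix u v assume uv: "u \<in> uverts H" "v \<in> uverts H"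
    show "{u, v} \<in> uedges H \<longleftrightarrow> {?g u, ?g v} \<in> uedges ?F"
    proof
      assume "{u, v} \<in> uedges H"
      then have "?g ` {u, v} \<in> uedges ?F" by (simp only: snd_conv image_eqI)
      then show "{?g u, ?g v} \<in> uedges ?F" by simp
    next
      assume "{?g u, ?g v} \<in> uedges ?F"
      then obtain E where E: "E \<in> uedges H" "?g ` {u, v} = ?g ` E" by auto
      then have "E \<subseteq> uverts H" using edges by (auto simp: nsets_def)
      then have "{u, v} = E" using E(2) inj_on_image_eq_iff[OF inj, of "{u, v}" E] uv by blast
      then show "{u, v} \<in> uedges H" using E by simp
    qed
  qed
  moreover have "inj_on c (uedges ?F)"
  proof -
    have oriented: "\<exists>u v. E = {u, v} \<and> u \<in> uverts H \<and> v \<in> uverts H \<and> h u < h v" if E: "E \<in> uedges H" for E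
    proof -
      obtain u v where uv: "E = {u, v}" "u \<in> uverts H" "v \<in> uverts H" "u \<noteq> v"
        using E edges nsets2_E by blast
      then have "h u \<noteq> h v" using h(1) by (auto simp: bij_betw_def inj_on_eq_iff)
      then show ?thesis using uv by (metis insert_commute linorder_neqE_nat)
    qed
    have "E = E'" if E: "E \<in> uedges H" "E' \<in> uedges H" "c (?g ` E) = c (?g ` E')" for E E'
    proof -
      obtain u v where uv: "E = {u, v}" "u \<in> uverts H" "v \<in> uverts H" "h u < h v"
        using oriented E by blast
      obtain u' v' where uv': "E' = {u', v'}" "u' \<in> uverts H" "v' \<in> uverts H" "h u' < h v'"
        using oriented E by blast
      have "h v = h v'" using later[of "h u" "h v" "h u'" "h v'"] uv uv' E(3) hm by simp
      then have "v = v'" using h(1) uv uv' by (auto simp: bij_betw_def inj_on_eq_iff)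
      then have "u = u'" using h(2)[of v u u'] uv uv' E by simp
      then show ?thesis using uv uv' \<open>v = v'\<close> by simp
    qed
    then show ?thesis by (auto intro!: inj_onI)
  qed
  ultimately show ?thesis unfolding contains_rainbow_copy_def by blast
qed

theorem theorem2p1:
  fixes m :: nat
  assumes "m \<ge> 2"
  shows "\<exists>D::real. D > 0 \<and>
    (\<forall>H :: nat ugraph. is_tree H \<and> card (uverts H) = m \<longrightarrow>
      (\<forall>n\<ge>2. \<forall>c :: nat set \<Rightarrow> nat.
        (\<forall>k. real (card {e \<in> uedges (complete_graph n). c e = k}) \<le> 1 / D * real (n choose 2)) \<longrightarrow>
        contains_rainbow_copy (complete_graph n) c H))"
proof -
  obtain K :: nat where K: "K > 0" "\<And>n (c :: nat set \<Rightarrow> nat).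
    \<lbrakk>2 \<le> n; \<And>k. K\<^sup>2 * card {e \<in> [{..<n}]\<^bsup>2\<^esup>. c e = k} \<le> n choose 2\<rbrakk> \<Longrightarrow>
    \<exists>e. inj_on e {..<m} \<and> e ` {..<m} \<subseteq> {..<n} \<and>
      (\<forall>i j i' j'. i < j \<longrightarrow> j < m \<longrightarrow> i' < j' \<longrightarrow> j' < m \<longrightarrow>
         c {e i, e j} = c {e i', e j'} \<longrightarrow> j = j')"
    using rare_colours_determine_later_endpoint[where m = m and ?'c = nat] by blast
  show ?thesis
  \<comment> \<open>With \<open>D\<close> equal to \<open>K\<^sup>2\<close>, clearing the
    denominator turns the hypothesis into the integer inequality used for sampling.\<close>
  proof (intro exI[of _ "real (K\<^sup>2)"] conjI allI impI)
    show "real (K\<^sup>2) > 0" using K(1) by simp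
    fix H :: "nat ugraph" and n :: nat and c :: "nat set \<Rightarrow> nat"
    assume H: "is_tree H \<and> card (uverts H) = m" and n: "2 \<le> n"
      and rare: "\<forall>k. real (card {e \<in> uedges (complete_graph n). c e = k})
        \<le> 1 / real (K\<^sup>2) * real (n choose 2)"
    have "K\<^sup>2 * card {e \<in> [{..<n}]\<^bsup>2\<^esup>. c e = k} \<le> n choose 2" for k
    proof -
      have "real (card {e \<in> [{..<n}]\<^bsup>2\<^esup>. c e = k}) \<le> real (n choose 2) / real (K\<^sup>2)"
        using rare by (simp add: complete_graph_def)
      then have "real (K\<^sup>2 * card {e \<in> [{..<n}]\<^bsup>2\<^esup>. c e = k}) \<le> real (n choose 2)"
        using K(1) by (simp add: pos_le_divide_eq mult.commute)
      then show ?thesis by (simp only: of_nat_le_iff)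
    qed
    from K(2)[OF n this] show "contains_rainbow_copy (complete_graph n) c H"
      using H rainbow_copy_of_acyclic[of H m _ n c] unfolding is_tree_def by blast
  qed
qed

end
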